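(* Let $N\ge0$ be an integer. The map $\mu\mapsto Q_\mu$ from finite signed Borel measures on $[0,1]$ to matrices indexed by $I_N\times I_N$ factors exactly through the $2N+1$ coordinates $$\int_{[0,1]}\omega\,d\mu(\omega),\qquad\int_{[0,1]}\sin(2\pi k\omega)\,d\mu(\omega),\qquad\int_{[0,1]}\omega\cos(2\pi k\omega)\,d\mu(\omega)\qquad(1\le k\le N),$$ and the induced map on these coordinates is injective: two finite signed Borel measures $\mu,\nu$ on $[0,1]$ satisfy $Q_\mu=Q_\nu$ if and only if all $2N+1$ of these coordinates agree for $\mu$ and $\nu$.
   Context: Notation. $I_N=\{-N,\dots,N\}$. For a $C^1$ function $\psi$ on $\mathbb R$, $Q_\psi$ is the matrix indexed by $I_N\times I_N$ with $(Q_\psi)_{mn}=\frac{\psi(m)-\psi(n)}{m-n}$ for $m\ne n$ and $(Q_\psi)_{mm}=\psi'(m)$. For a finite signed Borel measure $\mu$ on $[0,1]$ put $$\psi_\mu(x)=\frac1\pi\int_{[0,1]}\sin(2\pi\omega x)\,d\mu(\omega),\qquad Q_\mu:=Q_{\psi_\mu}.$$ *)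

theory Defs
  imports "HOL-Analysis.Analysis"
begin

text \<open>
  As usual, \<^term>\<open>M :: 'a measure\<close> serves here only as a carrier of the measurable space
  \<open>(space M, sets M)\<close>. Since \<open>\<mu>\<close> is real-valued, it is automatically of finite total variation;
  its values outside \<open>sets M\<close> carry no information.
\<close>
definition finite_signed_measure :: "'a measure \<Rightarrow> ('a set \<Rightarrow> real) \<Rightarrow> bool" where
  "finite_signed_measure M \<mu> \<longleftrightarrow>
     \<mu> {} = 0 \<and>
     (\<forall>A :: nat \<Rightarrow> 'a set. range A \<subseteq> sets M \<longrightarrow> disjoint_family A \<longrightarrow>
        (\<lambda>i. \<mu> (A i)) sums \<mu> (\<Union>i. A i))"

text \<open>
  The positive part in the Jordan decomposition, \<open>\<mu>\<^sup>+(A) = sup {\<mu>(B) | B \<subseteq> A measurable}\<close>.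
  The truncation of negative values by \<^const>\<open>ennreal\<close> is harmless because \<open>B = {}\<close> contributes 0.
\<close>
definition positive_variation :: "'a measure \<Rightarrow> ('a set \<Rightarrow> real) \<Rightarrow> 'a measure" where
  "positive_variation M \<mu> =
     measure_of (space M) (sets M) (\<lambda>A. SUP B\<in>{B \<in> sets M. B \<subseteq> A}. ennreal (\<mu> B))"

definition negative_variation :: "'a measure \<Rightarrow> ('a set \<Rightarrow> real) \<Rightarrow> 'a measure" where
  "negative_variation M \<mu> = positive_variation M (\<lambda>A. - \<mu> A)"

definition signed_integral :: "'a measure \<Rightarrow> ('a set \<Rightarrow> real) \<Rightarrow> ('a \<Rightarrow> real) \<Rightarrow> real" where
  "signed_integral M \<mu> f =
     (\<integral>x. f x \<partial>positive_variation M \<mu>) - (\<integral>x. f x \<partial>negative_variation M \<mu>)"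

abbreviation borel01 :: "real measure" where
  "borel01 \<equiv> restrict_space borel {0..1}"

definition index_set :: "nat \<Rightarrow> int set" where
  "index_set N = {- int N..int N}"

text \<open>
  A matrix indexed by \<open>I\<^sub>N \<times> I\<^sub>N\<close> is a function on \<^typ>\<open>int \<times> int\<close> that is extensional on that
  index set, so that equality of functions is equality of matrices.
\<close>
definition Q_mat :: "nat \<Rightarrow> (real \<Rightarrow> real) \<Rightarrow> int \<times> int \<Rightarrow> real" where
  "Q_mat N \<psi> = (\<lambda>(m, n) \<in> index_set N \<times> index_set N.
     if m = n then deriv \<psi> (of_int m)
     else (\<psi> (of_int m) - \<psi> (of_int n)) / (of_int m - of_int n))"

definition psi :: "(real set \<Rightarrow> real) \<Rightarrow> real \<Rightarrow> real" where
  "psi \<mu> x = 1 / pi * signed_integral borel01 \<mu> (\<lambda>\<omega>. sin (2 * pi * \<omega> * x))"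

definition Q_meas :: "nat \<Rightarrow> (real set \<Rightarrow> real) \<Rightarrow> int \<times> int \<Rightarrow> real" where
  "Q_meas N \<mu> = Q_mat N (psi \<mu>)"

definition coord_lin :: "(real set \<Rightarrow> real) \<Rightarrow> real" where
  "coord_lin \<mu> = signed_integral borel01 \<mu> (\<lambda>\<omega>. \<omega>)"

definition coord_sin :: "nat \<Rightarrow> (real set \<Rightarrow> real) \<Rightarrow> real" where
  "coord_sin k \<mu> = signed_integral borel01 \<mu> (\<lambda>\<omega>. sin (2 * pi * real k * \<omega>))"

definition coord_cos :: "nat \<Rightarrow> (real set \<Rightarrow> real) \<Rightarrow> real" where
  "coord_cos k \<mu> = signed_integral borel01 \<mu> (\<lambda>\<omega>. \<omega> * cos (2 * pi * real k * \<omega>))"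

definition coords :: "nat \<Rightarrow> (real set \<Rightarrow> real) \<Rightarrow> real list" where
  "coords N \<mu> =
     coord_lin \<mu> # map (\<lambda>k. coord_sin k \<mu>) [1..<N + 1] @ map (\<lambda>k. coord_cos k \<mu>) [1..<N + 1]"

lemma length_coords: "length (coords N \<mu>) = 2 * N + 1"
  by (simp add: coords_def)

end

theory Submission
  imports Defs
begin

text \<open>
  Differentiating \<open>\<psi>\<^sub>\<mu>\<close> under the integral sign gives \<open>\<psi>\<^sub>\<mu>'(x) = 2 \<integral> \<omega> cos (2\<pi>\<omega>x) d\<mu>(\<omega>)\<close>. At an
  integer \<open>m\<close> the numbers \<open>\<psi>\<^sub>\<mu>(m)\<close> and \<open>\<psi>\<^sub>\<mu>'(m)\<close> are therefore, up to sign and the factors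
  \<open>1/\<pi>\<close> and \<open>2\<close>, the sine coordinate and the cosine coordinate of index \<open>\<bar>m\<bar>\<close>; for \<open>m = 0\<close> they
  are \<open>0\<close> and twice the linear coordinate. As \<open>Q\<^sub>\<mu>\<close> is built from these numbers with \<open>\<bar>m\<bar> \<le> N\<close>,
  it is a function of the coordinates. Conversely the coordinates are visible in the matrix:
  the diagonal is \<open>\<psi>\<^sub>\<mu>'(m)\<close>, and since \<open>\<psi>\<^sub>\<mu>(0) = 0\<close> the column of index \<open>0\<close> has the entries
  \<open>\<psi>\<^sub>\<mu>(m)/m\<close> for \<open>m \<noteq> 0\<close>.

  The analytic content is the exchange of derivative and integral. It follows from dominated
  convergence once the variations of \<open>\<mu>\<close> are known to be finite measures, and this rests on the
  classical fact that a real-valued countably additive set function is bounded.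
\<close>

section \<open>Boundedness of finite signed measures\<close>

lemma finite_signed_measure_Diff:
  assumes \<mu>: "finite_signed_measure M \<mu>"
    and "A \<in> sets M" "B \<in> sets M" "B \<subseteq> A"
  shows "\<mu> (A - B) = \<mu> A - \<mu> B"
proof -
  define E where "E n = (if n = 0 then B else if n = 1 then A - B else {})" for n :: nat
  have "range E \<subseteq> sets M" "disjoint_family E"
    using assms by (auto simp: E_def disjoint_family_on_def)
  then have "(\<lambda>n. \<mu> (E n)) sums \<mu> (\<Union>n. E n)"
    using \<mu> by (simp add: finite_signed_measure_def)
  moreover have "(\<Union>n. E n) = A"
  proof -
    have "(\<Union>n. E n) \<subseteq> A"
      using \<open>B \<subseteq> A\<close> by (auto simp: E_def split: if_splits)
    moreover have "E 0 \<union> E 1 = A"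
      using \<open>B \<subseteq> A\<close> by (auto simp: E_def)
    ultimately show ?thesis by blast
  qed
  moreover have "(\<lambda>n. \<mu> (E n)) sums (\<Sum>n\<in>{0, 1}. \<mu> (E n))"
    using \<mu> by (intro sums_finite) (auto simp: E_def finite_signed_measure_def)
  ultimately have "\<mu> A = \<mu> (E 0) + \<mu> (E 1)"
    by (simp add: sums_iff)
  then show ?thesis
    by (simp add: E_def)
qed

text \<open>
  If \<open>\<mu>\<close> is unbounded on the measurable subsets of \<open>A\<close>, take \<open>B \<subseteq> A\<close> with
  \<open>\<bar>\<mu> B\<bar> > \<bar>\<mu> A\<bar> + 1\<close>. Then both \<open>B\<close> and \<open>A - B\<close> have mass at least \<open>1\<close> in absolute value, and \<open>\<mu>\<close>
  is unbounded below one of them. Keeping that piece and discarding the other, again and again,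
  yields infinitely many disjoint sets of mass at least \<open>1\<close>, against countable additivity.
\<close>
lemma finite_signed_measure_bounded:
  assumes \<mu>: "finite_signed_measure M \<mu>"
  obtains c where "\<And>B. B \<in> sets M \<Longrightarrow> \<bar>\<mu> B\<bar> \<le> c"
proof -
  define unbounded_on where
    "unbounded_on A \<longleftrightarrow> (\<forall>c. \<exists>B\<in>sets M. B \<subseteq> A \<and> \<bar>\<mu> B\<bar> > c)" for A
  have split: "\<exists>B. (B \<in> sets M \<and> unbounded_on B) \<and> B \<subseteq> A \<and> 1 \<le> \<bar>\<mu> (A - B)\<bar>"
    if A: "A \<in> sets M" "unbounded_on A" for A
  proof -
    obtain B where B: "B \<in> sets M" "B \<subseteq> A" "\<bar>\<mu> B\<bar> > \<bar>\<mu> A\<bar> + 1"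
      using A by (auto simp: unbounded_on_def)
    have AB: "\<mu> (A - B) = \<mu> A - \<mu> B"
      using \<mu> A B by (intro finite_signed_measure_Diff)
    show ?thesis
    proof (cases "unbounded_on B")
      case True
      then show ?thesis using B AB by (intro exI[of _ B]) auto
    next
      case False
      then obtain b where b: "\<And>D. D \<in> sets M \<Longrightarrow> D \<subseteq> B \<Longrightarrow> \<bar>\<mu> D\<bar> \<le> b"
        by (force simp: unbounded_on_def not_less)
      have "unbounded_on (A - B)"
        unfolding unbounded_on_def
      proof
        fix c
        obtain C where C: "C \<in> sets M" "C \<subseteq> A" "\<bar>\<mu> C\<bar> > c + b"
          using A by (auto simp: unbounded_on_def)
        have "\<mu> (C - C \<inter> B) = \<mu> C - \<mu> (C \<inter> B)"
          using \<mu> B C by (intro finite_signed_measure_Diff) auto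
        moreover have "\<bar>\<mu> (C \<inter> B)\<bar> \<le> b"
          using B C by (intro b) auto
        ultimately have "\<bar>\<mu> (C - C \<inter> B)\<bar> > c"
          using C by linarith
        moreover have "C - C \<inter> B \<in> sets M" "C - C \<inter> B \<subseteq> A - B"
          using B C by auto
        ultimately show "\<exists>D\<in>sets M. D \<subseteq> A - B \<and> \<bar>\<mu> D\<bar> > c"
          by blast
      qed
      moreover have "A - (A - B) = B"
        using B by auto
      ultimately show ?thesis
        using A B by (intro exI[of _ "A - B"]) auto
    qed
  qed
  have "\<not> unbounded_on (space M)"
  proof
    assume "unbounded_on (space M)"
    then have "\<exists>A. A \<in> sets M \<and> unbounded_on A"
      by blast
    then obtain A where A: "\<And>n. A n \<in> sets M \<and> unbounded_on (A n)"
        "\<And>n. A (Suc n) \<subseteq> A n \<and> 1 \<le> \<bar>\<mu> (A n - A (Suc n))\<bar>"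
      using dependent_nat_choice[where P = "\<lambda>_ A. A \<in> sets M \<and> unbounded_on A"
          and Q = "\<lambda>_ A B. B \<subseteq> A \<and> 1 \<le> \<bar>\<mu> (A - B)\<bar>"] split
      by (metis (lifting))
    define D where "D n = A n - A (Suc n)" for n
    have "decseq A"
      using A by (simp add: decseq_Suc_iff)
    have "D m \<inter> D n = {}" if "m < n" for m n
      using decseqD[OF \<open>decseq A\<close>, of "Suc m" n] that by (auto simp: D_def)
    then have "disjoint_family D"
      unfolding disjoint_family_on_def by (metis Int_commute linorder_neqE_nat)
    moreover have "range D \<subseteq> sets M"
      using A by (auto simp: D_def)
    ultimately have "(\<lambda>n. \<mu> (D n)) sums \<mu> (\<Union>n. D n)"
      using \<mu> by (simp add: finite_signed_measure_def)
    then have "(\<lambda>n. \<mu> (D n)) \<longlonglongrightarrow> 0"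
      by (intro summable_LIMSEQ_zero sums_summable)
    then have "\<forall>\<^sub>F n in sequentially. \<bar>\<mu> (D n)\<bar> < 1"
      by (auto dest: tendstoD[where e = 1])
    then obtain n where "\<bar>\<mu> (D n)\<bar> < 1"
      by (auto simp: eventually_sequentially)
    moreover have "1 \<le> \<bar>\<mu> (D n)\<bar>"
      using A by (simp add: D_def)
    ultimately show False
      by simp
  qed
  then obtain c where "\<forall>B\<in>sets M. B \<subseteq> space M \<longrightarrow> \<bar>\<mu> B\<bar> \<le> c"
    by (auto simp: unbounded_on_def not_less)
  then show thesis
    using that sets.sets_into_space by metis
qed

lemma space_positive_variation [simp]: "space (positive_variation M \<mu>) = space M"
  and sets_positive_variation [simp, measurable_cong]: "sets (positive_variation M \<mu>) = sets M"
  by (simp_all add: positive_variation_def)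

text \<open>
  The bound of \<open>\<mu>\<close> bounds the supremum that defines the positive variation. That supremum is
  an upper bound for the measure of every set by the very construction of \<^const>\<open>measure_of\<close>,
  which takes either the values of the given set function or the value \<open>0\<close>.
\<close>
lemma finite_measure_positive_variation:
  assumes "finite_signed_measure M \<mu>"
  shows "finite_measure (positive_variation M \<mu>)"
proof
  obtain c where c: "\<And>B. B \<in> sets M \<Longrightarrow> \<bar>\<mu> B\<bar> \<le> c"
    using finite_signed_measure_bounded assms by blast
  have "emeasure (positive_variation M \<mu>) (space M)
      \<le> (SUP B\<in>{B \<in> sets M. B \<subseteq> space M}. ennreal (\<mu> B))"
    unfolding positive_variation_def
    by (simp add: emeasure_measure_of_conv sets.sigma_sets_eq)
  also have "\<dots> \<le> ennreal c"
    using c by (intro SUP_least ennreal_leI) (auto dest: order_trans[OF abs_ge_self])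
  finally show "emeasure (positive_variation M \<mu>) (space (positive_variation M \<mu>)) \<noteq> \<infinity>"
    by (auto simp: top_unique)
qed

lemma finite_signed_measure_uminus:
  "finite_signed_measure M \<mu> \<Longrightarrow> finite_signed_measure M (\<lambda>A. - \<mu> A)"
  by (auto simp: finite_signed_measure_def intro: sums_minus)

section \<open>Differentiating the sine transform\<close>

lemma abs_sin_diff_le_abs_diff: "\<bar>sin x - sin y\<bar> \<le> \<bar>x - y\<bar>" for x y :: real
proof -
  have "\<bar>sin x - sin y\<bar> = 2 * (\<bar>sin ((x - y) / 2)\<bar> * \<bar>cos ((x + y) / 2)\<bar>)"
    by (simp add: sin_diff_sin abs_mult)
  also have "\<dots> \<le> 2 * (\<bar>(x - y) / 2\<bar> * 1)"
    by (intro mult_left_mono mult_mono abs_sin_x_le_abs_x abs_cos_le_one) auto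
  finally show ?thesis
    by simp
qed

text \<open>
  The difference quotients of \<open>x \<mapsto> sin (f \<omega> x)\<close> are bounded by \<open>\<bar>f \<omega>\<bar>\<close> because the sine is
  1-Lipschitz, so a bound on \<open>f\<close> dominates them all on a finite measure space.
\<close>
lemma has_real_derivative_integral_sin:
  fixes f :: "'a \<Rightarrow> real"
  assumes "finite_measure M" and [measurable]: "f \<in> borel_measurable M"
    and bound: "\<And>\<omega>. \<omega> \<in> space M \<Longrightarrow> \<bar>f \<omega>\<bar> \<le> C"
  shows "((\<lambda>x. \<integral>\<omega>. sin (f \<omega> * x) \<partial>M) has_real_derivative
           (\<integral>\<omega>. f \<omega> * cos (f \<omega> * x) \<partial>M)) (at x)"
  unfolding has_field_derivative_iff
proof (subst tendsto_at_iff_sequentially, intro allI impI)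
  interpret finite_measure M by fact
  fix Y :: "nat \<Rightarrow> real"
  assume Y: "\<forall>i. Y i \<in> UNIV - {x}" "Y \<longlonglongrightarrow> x"
  define q where "q i \<omega> = (sin (f \<omega> * Y i) - sin (f \<omega> * x)) / (Y i - x)" for i \<omega>
  have integrable_sin: "integrable M (\<lambda>\<omega>. sin (f \<omega> * y))" for y
    by (intro integrable_const_bound[where B = 1]) auto
  have "(\<lambda>i. \<integral>\<omega>. q i \<omega> \<partial>M) \<longlonglongrightarrow> (\<integral>\<omega>. f \<omega> * cos (f \<omega> * x) \<partial>M)"
  proof (rule integral_dominated_convergence[where w = "\<lambda>_. C"])
    have "(\<lambda>i. q i \<omega>) \<longlonglongrightarrow> f \<omega> * cos (f \<omega> * x)" for \<omega>
    proof -
      have "((\<lambda>y. sin (f \<omega> * y)) has_real_derivative f \<omega> * cos (f \<omega> * x)) (at x)"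
        by (auto intro!: derivative_eq_intros)
      then have "((\<lambda>y. (sin (f \<omega> * y) - sin (f \<omega> * x)) / (y - x)) \<longlongrightarrow> f \<omega> * cos (f \<omega> * x)) (at x)"
        by (simp add: has_field_derivative_iff)
      then show ?thesis
        using Y unfolding q_def tendsto_at_iff_sequentially by (auto simp: comp_def)
    qed
    then show "AE \<omega> in M. (\<lambda>i. q i \<omega>) \<longlonglongrightarrow> f \<omega> * cos (f \<omega> * x)"
      by simp
    show "AE \<omega> in M. norm (q i \<omega>) \<le> C" for i
    proof (rule AE_I2)
      fix \<omega> assume "\<omega> \<in> space M"
      have "\<bar>sin (f \<omega> * Y i) - sin (f \<omega> * x)\<bar> \<le> \<bar>f \<omega> * Y i - f \<omega> * x\<bar>"
        by (rule abs_sin_diff_le_abs_diff)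
      also have "\<dots> = \<bar>f \<omega>\<bar> * \<bar>Y i - x\<bar>"
        by (simp add: abs_mult flip: right_diff_distrib)
      also have "\<dots> \<le> C * \<bar>Y i - x\<bar>"
        using bound[OF \<open>\<omega> \<in> space M\<close>] by (intro mult_right_mono) auto
      finally show "norm (q i \<omega>) \<le> C"
        using Y by (simp add: q_def divide_le_eq)
    qed
  qed (simp_all add: q_def)
  moreover have "(\<integral>\<omega>. q i \<omega> \<partial>M)
      = ((\<integral>\<omega>. sin (f \<omega> * Y i) \<partial>M) - (\<integral>\<omega>. sin (f \<omega> * x) \<partial>M)) / (Y i - x)" for i
    by (simp add: q_def integrable_sin)
  ultimately show "((\<lambda>y. ((\<integral>\<omega>. sin (f \<omega> * y) \<partial>M) - (\<integral>\<omega>. sin (f \<omega> * x) \<partial>M)) / (y - x)) \<circ> Y)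
      \<longlonglongrightarrow> (\<integral>\<omega>. f \<omega> * cos (f \<omega> * x) \<partial>M)"
    by (simp add: comp_def)
qed

lemma deriv_psi:
  assumes "finite_signed_measure borel01 \<mu>"
  shows "deriv (psi \<mu>) x = 2 * signed_integral borel01 \<mu> (\<lambda>\<omega>. \<omega> * cos (2 * pi * \<omega> * x))"
proof (rule DERIV_imp_deriv)
  have D: "((\<lambda>x. \<integral>\<omega>. sin (2 * pi * \<omega> * x) \<partial>positive_variation borel01 \<nu>) has_real_derivative
      2 * pi * (\<integral>\<omega>. \<omega> * cos (2 * pi * \<omega> * x) \<partial>positive_variation borel01 \<nu>)) (at x)"
    if "finite_signed_measure borel01 \<nu>" for \<nu>
  proof -
    have "(\<lambda>\<omega>. 2 * pi * \<omega>) \<in> borel_measurable (positive_variation borel01 \<nu>)"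
      by (simp add: measurable_restrict_space1 cong: measurable_cong_sets)
    then have "((\<lambda>x. \<integral>\<omega>. sin (2 * pi * \<omega> * x) \<partial>positive_variation borel01 \<nu>) has_real_derivative
        (\<integral>\<omega>. 2 * pi * \<omega> * cos (2 * pi * \<omega> * x) \<partial>positive_variation borel01 \<nu>)) (at x)"
      using that
      by (intro has_real_derivative_integral_sin[where C = "2 * pi"]
            finite_measure_positive_variation)
         (auto simp: space_restrict_space abs_mult)
    then show ?thesis
      by (simp add: mult.assoc)
  qed
  note pos = D[OF assms] and neg = D[OF finite_signed_measure_uminus[OF assms]]
  show "(psi \<mu> has_real_derivative
      2 * signed_integral borel01 \<mu> (\<lambda>\<omega>. \<omega> * cos (2 * pi * \<omega> * x))) (at x)"
    unfolding psi_def[abs_def] signed_integral_def negative_variation_def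
    by (rule DERIV_cong[OF DERIV_cmult[OF DERIV_diff[OF pos neg]]]) (simp add: right_diff_distrib)
qed

section \<open>Matrix entries and coordinates\<close>

lemma psi_0: "psi \<mu> 0 = 0"
  by (simp add: psi_def signed_integral_def)

lemma psi_minus: "psi \<mu> (- x) = - psi \<mu> x"
  by (simp add: psi_def signed_integral_def diff_divide_distrib)

lemma psi_of_nat: "psi \<mu> (real k) = coord_sin k \<mu> / pi"
  by (simp add: psi_def coord_sin_def ac_simps)

lemma coord_cos_0: "coord_cos 0 \<mu> = coord_lin \<mu>"
  by (simp add: coord_cos_def coord_lin_def)

lemma coord_sin_0: "coord_sin 0 \<mu> = 0"
  by (simp add: coord_sin_def signed_integral_def)

lemma psi_of_int: "psi \<mu> (of_int m) = of_int (sgn m) * coord_sin (nat \<bar>m\<bar>) \<mu> / pi"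
proof (cases "m \<ge> 0")
  case True
  then obtain k where "m = int k" by (rule nonneg_int_cases)
  then show ?thesis by (cases "k = 0") (simp_all add: psi_of_nat psi_0)
next
  case False
  then obtain k where "m = - int k" "k > 0" by (rule_tac neg_int_cases[of m]) auto
  then show ?thesis by (simp add: psi_of_nat psi_minus)
qed

lemma deriv_psi_of_int:
  assumes "finite_signed_measure borel01 \<mu>"
  shows "deriv (psi \<mu>) (of_int m) = 2 * coord_cos (nat \<bar>m\<bar>) \<mu>"
proof -
  have "cos (2 * pi * \<omega> * of_int m) = cos (2 * pi * real (nat \<bar>m\<bar>) * \<omega>)" for \<omega>
    by (cases "m \<ge> 0") (simp_all add: ac_simps)
  then show ?thesis
    by (simp add: deriv_psi[OF assms] coord_cos_def)
qed

lemma Q_meas_eq_iff: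
  assumes \<mu>: "finite_signed_measure borel01 \<mu>" and \<nu>: "finite_signed_measure borel01 \<nu>"
  shows "Q_meas N \<mu> = Q_meas N \<nu> \<longleftrightarrow>
    coord_lin \<mu> = coord_lin \<nu> \<and>
    (\<forall>k\<in>{1..N}. coord_sin k \<mu> = coord_sin k \<nu>) \<and>
    (\<forall>k\<in>{1..N}. coord_cos k \<mu> = coord_cos k \<nu>)"
    (is "?Q \<longleftrightarrow> ?coords")
proof
  assume eq: ?Q
  have cos_eq: "coord_cos k \<mu> = coord_cos k \<nu>" if "k \<le> N" for k
    using fun_cong[OF eq, of "(int k, int k)"] that
      deriv_psi_of_int[OF \<mu>, of "int k"] deriv_psi_of_int[OF \<nu>, of "int k"]
    by (simp add: Q_meas_def Q_mat_def index_set_def)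
  have "coord_sin k \<mu> = coord_sin k \<nu>" if "k \<in> {1..N}" for k
    using fun_cong[OF eq, of "(int k, 0)"] that
    by (simp add: Q_meas_def Q_mat_def index_set_def psi_0 psi_of_nat)
  then show ?coords
    using cos_eq cos_eq[of 0] by (simp add: coord_cos_0)
next
  assume c: ?coords
  have sin_eq: "coord_sin k \<mu> = coord_sin k \<nu>" if "k \<le> N" for k
    using c that by (cases "k = 0") (auto simp: coord_sin_0)
  have cos_eq: "coord_cos k \<mu> = coord_cos k \<nu>" if "k \<le> N" for k
    using c that by (cases "k = 0") (auto simp: coord_cos_0)
  show ?Q
    unfolding Q_meas_def Q_mat_def
    by (rule restrict_ext)
       (auto simp: index_set_def deriv_psi_of_int[OF \<mu>] deriv_psi_of_int[OF \<nu>] psi_of_int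
          sin_eq cos_eq abs_le_iff nat_le_iff)
qed

lemma coords_eq_iff:
  "coords N \<mu> = coords N \<nu> \<longleftrightarrow>
    coord_lin \<mu> = coord_lin \<nu> \<and>
    (\<forall>k\<in>{1..N}. coord_sin k \<mu> = coord_sin k \<nu>) \<and>
    (\<forall>k\<in>{1..N}. coord_cos k \<mu> = coord_cos k \<nu>)"
  by (simp add: coords_def atLeastLessThanSuc_atLeastAtMost del: upt_Suc)

theorem corollary2p4:
  fixes N :: nat
  shows "(\<exists>F :: real list \<Rightarrow> int \<times> int \<Rightarrow> real.
            (\<forall>\<mu>. finite_signed_measure borel01 \<mu> \<longrightarrow> Q_meas N \<mu> = F (coords N \<mu>)) \<and>
            inj_on F (coords N ` {\<mu>. finite_signed_measure borel01 \<mu>})) \<and>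
         (\<forall>\<mu> \<nu>. finite_signed_measure borel01 \<mu> \<longrightarrow> finite_signed_measure borel01 \<nu> \<longrightarrow>
            (Q_meas N \<mu> = Q_meas N \<nu> \<longleftrightarrow>
               coord_lin \<mu> = coord_lin \<nu> \<and>
               (\<forall>k\<in>{1..N}. coord_sin k \<mu> = coord_sin k \<nu>) \<and>
               (\<forall>k\<in>{1..N}. coord_cos k \<mu> = coord_cos k \<nu>)))"
proof (intro conjI allI impI)
  let ?S = "{\<mu>. finite_signed_measure borel01 \<mu>}"
  have iff: "Q_meas N \<mu> = Q_meas N \<nu> \<longleftrightarrow> coords N \<mu> = coords N \<nu>" if "\<mu> \<in> ?S" "\<nu> \<in> ?S" for \<mu> \<nu>
    using that by (simp add: Q_meas_eq_iff coords_eq_iff)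
  (* Choose any signed measure with the given coordinates: its matrix does not depend on the choice. *)
  define F where "F = Q_meas N \<circ> inv_into ?S (coords N)"
  have F: "F (coords N \<mu>) = Q_meas N \<mu>" if "\<mu> \<in> ?S" for \<mu>
  proof -
    have "coords N \<mu> \<in> coords N ` ?S"
      using that by (rule imageI)
    from iff[OF inv_into_into[OF this] that] f_inv_into_f[OF this] show ?thesis
      by (simp add: F_def)
  qed
  have "inj_on F (coords N ` ?S)"
  proof (rule inj_onI)
    fix x y assume "x \<in> coords N ` ?S" "y \<in> coords N ` ?S" "F x = F y"
    then show "x = y" using F iff by auto
  qed
  with F show "\<exists>F. (\<forall>\<mu>. finite_signed_measure borel01 \<mu> \<longrightarrow> Q_meas N \<mu> = F (coords N \<mu>)) \<and>
      inj_on F (coords N ` ?S)"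
    by (intro exI[of _ F]) auto
qed (rule Q_meas_eq_iff)

end
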